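(* Let $X$ be a compact Riemannian manifold, and let $\{x_i\}_{i\ge1}$ be any sequence in $X\setminus B_r(p)$, where $B_r(p)$ is the open ball of center $p\in X$ and radius $r>0$. Then, for every $N\ge1$, $$W_1\left(\frac1N\sum_{i=1}^N\delta_{x_i},dx\right)\ge\frac r2\operatorname{vol}(B_{r/2}(p)),$$ and in particular $\frac1N\sum_{i=1}^N\delta_{x_i}$ does not converge to $dx$ as $N\to\infty$.
   Context: $\operatorname{dist}$ is the Riemannian distance on $X$, $dx$ is the Riemannian volume measure normalized so that $dx(X)=1$, and $\operatorname{vol}(B)=dx(B)$ denotes the normalized volume of a Borel set $B$. $\delta_p$ is the Dirac measure at $p$. For positive finite measures $\mu,\nu$ on $X$ of the same total mass, $W_1(\mu,\nu)=\min_\pi\int_{X\times X}\operatorname{dist}(x,y)\,d\pi(x,y)$, the minimum being over positive finite measures $\pi$ on $X\times X$ with marginals $\mu$ and $\nu$. Convergence of measures is in the sense of $W_1$ (equivalently, weak convergence of probability measures, as $X$ is compact). *)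

theory Defs
  imports "HOL-Analysis.Analysis" "HOL-Probability.Giry_Monad"
begin

section \<open>Smooth manifolds\<close>

text \<open>For open \<open>S\<close> this is the usual \<open>C\<^sup>k\<close>: all directional derivatives of order up to \<open>k\<close>
  are continuous, since \<open>f\<close> is Frechet differentiable and each \<open>x \<mapsto> Df(x) v\<close> is \<open>C\<^sup>k\<^sup>-\<^sup>1\<close>.\<close>

primrec Ck_on ::
  "nat \<Rightarrow> ('v::euclidean_space \<Rightarrow> 'w::real_normed_vector) \<Rightarrow> 'v set \<Rightarrow> bool" where
  "Ck_on 0 f S \<longleftrightarrow> continuous_on S f"
| "Ck_on (Suc k) f S \<longleftrightarrow>
     (\<forall>x\<in>S. f differentiable (at x)) \<and>
     (\<forall>v. Ck_on k (\<lambda>x. frechet_derivative f (at x) v) S)"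

definition smooth_on ::
  "('v::euclidean_space \<Rightarrow> 'w::real_normed_vector) \<Rightarrow> 'v set \<Rightarrow> bool" where
  "smooth_on f S \<longleftrightarrow> (\<forall>k. Ck_on k f S)"

text \<open>A chart is its domain together with its coordinate map. Only the values of the coordinate
  map on the domain matter. The points of the manifold are all points of the type \<open>'a\<close>, and
  \<open>CARD('n)\<close> is the dimension.\<close>

type_synonym ('a, 'n) chart = "'a set \<times> ('a \<Rightarrow> real ^ 'n)"

definition is_chart :: "('a::topological_space, 'n::finite) chart \<Rightarrow> bool" where
  "is_chart = (\<lambda>(U, \<phi>).
     open U \<and> open (\<phi> ` U) \<and> homeomorphism U (\<phi> ` U) \<phi> (inv_into U \<phi>))"

definition smooth_atlas :: "('a::topological_space, 'n::finite) chart set \<Rightarrow> bool" where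
  "smooth_atlas A \<longleftrightarrow>
     (\<forall>c\<in>A. is_chart c) \<and>
     (\<Union>(U, \<phi>)\<in>A. U) = UNIV \<and>
     (\<forall>(U, \<phi>)\<in>A. \<forall>(U', \<psi>)\<in>A. smooth_on (\<psi> \<circ> inv_into U \<phi>) (\<phi> ` (U \<inter> U')))"

section \<open>Riemannian metrics\<close>

text \<open>A field of bilinear forms is given by its coordinate expressions: \<open>g (U, \<phi>) x v w\<close> is the
  value at the point \<open>x\<close> of \<open>U\<close> on the two tangent vectors whose components with respect to the
  coordinate frame of \<open>(U, \<phi>)\<close> are \<open>v\<close> and \<open>w\<close>. The last clause is the tensor transformation
  law, which makes this independent of the chart.\<close>

type_synonym ('a, 'n) bilinear_field =
  "('a, 'n) chart \<Rightarrow> 'a \<Rightarrow> real ^ 'n \<Rightarrow> real ^ 'n \<Rightarrow> real"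

definition riemannian_metric ::
  "('a::topological_space, 'n::finite) chart set \<Rightarrow> ('a, 'n) bilinear_field \<Rightarrow> bool" where
  "riemannian_metric A g \<longleftrightarrow>
     (\<forall>(U, \<phi>)\<in>A. \<forall>x\<in>U.
        bilinear (g (U, \<phi>) x) \<and>
        (\<forall>v w. g (U, \<phi>) x v w = g (U, \<phi>) x w v) \<and>
        (\<forall>v. v \<noteq> 0 \<longrightarrow> g (U, \<phi>) x v v > 0)) \<and>
     (\<forall>(U, \<phi>)\<in>A. \<forall>v w. smooth_on (\<lambda>y. g (U, \<phi>) (inv_into U \<phi> y) v w) (\<phi> ` U)) \<and>
     (\<forall>(U, \<phi>)\<in>A. \<forall>(U', \<psi>)\<in>A. \<forall>x\<in>U \<inter> U'. \<forall>v w.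
        let D = frechet_derivative (\<psi> \<circ> inv_into U \<phi>) (at (\<phi> x))
        in g (U, \<phi>) x v w = g (U', \<psi>) x (D v) (D w))"

definition compact_riemannian_manifold ::
  "('a::{t2_space, second_countable_topology}, 'n::finite) chart set \<Rightarrow>
   ('a, 'n) bilinear_field \<Rightarrow> bool" where
  "compact_riemannian_manifold A g \<longleftrightarrow>
     compact (UNIV :: 'a set) \<and> smooth_atlas A \<and> riemannian_metric A g"

section \<open>Riemannian distance\<close>

definition C1_curve_on ::
  "('a::topological_space, 'n::finite) chart set \<Rightarrow> (real \<Rightarrow> 'a) \<Rightarrow> real \<Rightarrow> real \<Rightarrow> bool" where
  "C1_curve_on A \<gamma> a b \<longleftrightarrow>
     continuous_on {a..b} \<gamma> \<and>
     (\<forall>(U, \<phi>)\<in>A.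
        (\<forall>t\<in>{a..b}. \<gamma> t \<in> U \<longrightarrow> (\<phi> \<circ> \<gamma>) differentiable (at t within {a..b})) \<and>
        continuous_on {t\<in>{a..b}. \<gamma> t \<in> U}
          (\<lambda>t. vector_derivative (\<phi> \<circ> \<gamma>) (at t within {a..b})))"

text \<open>The finite set \<open>S\<close> contains the break points; on closed intervals without interior break
  points the curve is \<open>C\<^sup>1\<close> up to the end points (one-sidedly).\<close>

definition piecewise_C1_curve ::
  "('a::topological_space, 'n::finite) chart set \<Rightarrow> (real \<Rightarrow> 'a) \<Rightarrow> real \<Rightarrow> real \<Rightarrow> bool" where
  "piecewise_C1_curve A \<gamma> a b \<longleftrightarrow>
     continuous_on {a..b} \<gamma> \<and>
     (\<exists>S. finite S \<and>
        (\<forall>s t. a \<le> s \<and> s < t \<and> t \<le> b \<and> {s<..<t} \<inter> S = {} \<longrightarrow> C1_curve_on A \<gamma> s t))"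

text \<open>By the transformation law the choice of the chart around \<open>\<gamma> t\<close> is irrelevant wherever the
  curve is differentiable. At the end points and the finitely many break points the value is
  unspecified, which does not affect the length.\<close>

definition speed ::
  "('a::topological_space, 'n::finite) chart set \<Rightarrow> ('a, 'n) bilinear_field \<Rightarrow>
   (real \<Rightarrow> 'a) \<Rightarrow> real \<Rightarrow> real" where
  "speed A g \<gamma> t =
     (let (U, \<phi>) = (SOME c. c \<in> A \<and> \<gamma> t \<in> fst c);
          v = vector_derivative (\<phi> \<circ> \<gamma>) (at t)
      in sqrt (g (U, \<phi>) (\<gamma> t) v v))"

definition curve_length ::
  "('a::topological_space, 'n::finite) chart set \<Rightarrow> ('a, 'n) bilinear_field \<Rightarrow>
   (real \<Rightarrow> 'a) \<Rightarrow> real \<Rightarrow> real \<Rightarrow> ennreal" where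
  "curve_length A g \<gamma> a b = (\<integral>\<^sup>+t\<in>{a..b}. ennreal (speed A g \<gamma> t) \<partial>lborel)"

text \<open>The distance is \<open>\<infinity>\<close> between points of different connected components and finite
  within each component.\<close>

definition riem_dist ::
  "('a::topological_space, 'n::finite) chart set \<Rightarrow> ('a, 'n) bilinear_field \<Rightarrow>
   'a \<Rightarrow> 'a \<Rightarrow> ennreal" where
  "riem_dist A g x y =
     Inf {curve_length A g \<gamma> a b | \<gamma> a b.
       a \<le> b \<and> piecewise_C1_curve A \<gamma> a b \<and> \<gamma> a = x \<and> \<gamma> b = y}"

definition riem_ball ::
  "('a::topological_space, 'n::finite) chart set \<Rightarrow> ('a, 'n) bilinear_field \<Rightarrow>
   'a \<Rightarrow> real \<Rightarrow> 'a set" where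
  "riem_ball A g p r = {x. riem_dist A g p x < ennreal r}"

section \<open>Riemannian volume\<close>

definition volume_density ::
  "('a, 'n::finite) bilinear_field \<Rightarrow> ('a, 'n) chart \<Rightarrow> 'a \<Rightarrow> real" where
  "volume_density g c x = sqrt (det (\<chi> i j. g c x (axis i 1) (axis j 1)))"

text \<open>The Riemannian volume measure is the unique Borel measure which in every chart is
  \<open>sqrt (det (g\<^sub>i\<^sub>j)) dy\<close>.\<close>

definition is_riemannian_volume ::
  "('a::topological_space, 'n::finite) chart set \<Rightarrow> ('a, 'n) bilinear_field \<Rightarrow>
   'a measure \<Rightarrow> bool" where
  "is_riemannian_volume A g V \<longleftrightarrow>
     sets V = sets borel \<and>
     (\<forall>(U, \<phi>)\<in>A. \<forall>B\<in>sets borel. B \<subseteq> U \<longrightarrow>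
        emeasure V B =
          (\<integral>\<^sup>+y\<in>\<phi> ` B. ennreal (volume_density g (U, \<phi>) (inv_into U \<phi> y)) \<partial>lborel))"

definition normalized :: "'a measure \<Rightarrow> 'a measure" where
  "normalized V = scale_measure (inverse (emeasure V (space V))) V"

section \<open>Wasserstein distance\<close>

definition couplings :: "'a measure \<Rightarrow> 'b measure \<Rightarrow> ('a \<times> 'b) measure set" where
  "couplings \<mu> \<nu> =
     {\<pi>. finite_measure \<pi> \<and> sets \<pi> = sets (\<mu> \<Otimes>\<^sub>M \<nu>) \<and> distr \<pi> \<mu> fst = \<mu> \<and> distr \<pi> \<nu> snd = \<nu>}"

definition W1 :: "('a \<Rightarrow> 'a \<Rightarrow> ennreal) \<Rightarrow> 'a measure \<Rightarrow> 'a measure \<Rightarrow> ennreal" where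
  "W1 d \<mu> \<nu> = (INF \<pi>\<in>couplings \<mu> \<nu>. \<integral>\<^sup>+(x, y). d x y \<partial>\<pi>)"

definition W1_converges ::
  "('a \<Rightarrow> 'a \<Rightarrow> ennreal) \<Rightarrow> (nat \<Rightarrow> 'a measure) \<Rightarrow> 'a measure \<Rightarrow> bool" where
  "W1_converges d \<mu> \<nu> \<longleftrightarrow> (\<lambda>N. W1 d (\<mu> N) \<nu>) \<longlonglongrightarrow> 0"

text \<open>The Dirac measure at \<open>z\<close> is \<open>return borel z\<close>. Sequences are indexed from 1.\<close>

definition empirical_measure :: "(nat \<Rightarrow> 'a::topological_space) \<Rightarrow> nat \<Rightarrow> 'a measure" where
  "empirical_measure x N =
     measure_of UNIV (sets borel)
       (\<lambda>B. (1 / of_nat N) * (\<Sum>i=1..N. emeasure (return borel (x i)) B))"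

end

theory Submission
  imports Defs
begin

text \<open>If \<open>y\<close> lies within \<open>r / 2\<close> of \<open>p\<close>, then it has distance at least \<open>r / 2\<close> from every \<open>x\<^sub>i\<close>, by
  the triangle inequality. Every coupling of the empirical measure with \<open>dx\<close> moves the mass that
  \<open>dx\<close> puts on the ball from the points \<open>x\<^sub>i\<close>, so it costs at least \<open>r / 2\<close> times that mass.
  For the failure of convergence the same bound is applied to a coordinate ball around \<open>p\<close> inside
  the metric ball: its volume is positive because the volume density is continuous and positive.\<close>

section \<open>Lower integrals of arbitrary functions\<close>

text \<open>The distance is an infimum of lengths, so its triangle inequality has to be produced by
  operating on curves, through reversal and concatenation. The new curve only has to be no longer
  than the old ones together, hence one-sided estimates for lower integrals suffice.

  Another obstacle is that \<open>emeasure\<close> is 0 off the sigma-algebra, so a positive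
  constant for the failure of convergence must come from a set known to be Borel. A coordinate ball
  is open. It lies in the metric ball when its radius is small, because the metric is locally
  dominated by a multiple of the Euclidean one, so straight coordinate segments are short.\<close>

text \<open>Proving that speeds are measurable is avoided: the lower integral, which is what
  \<open>nn_integral\<close> computes for arbitrary functions, already behaves well enough.\<close>

lemma nn_integral_lborel_reflect:
  fixes f :: "real \<Rightarrow> ennreal"
  shows "(\<integral>\<^sup>+t. f (c - t) \<partial>lborel) = (\<integral>\<^sup>+t. f t \<partial>lborel)"
proof -
  have le: "(\<integral>\<^sup>+t. f (c - t) \<partial>lborel) \<le> (\<integral>\<^sup>+t. f t \<partial>lborel)" for f :: "real \<Rightarrow> ennreal"
    unfolding nn_integral_def[of lborel "\<lambda>t. f (c - t)"]
  proof (rule SUP_least, safe)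
    fix s :: "real \<Rightarrow> ennreal"
    assume s: "simple_function lborel s" "s \<le> (\<lambda>t. f (c - t))"
    have [measurable]: "s \<in> borel_measurable borel"
      using borel_measurable_simple_function[OF s(1)] by simp
    have "integral\<^sup>S lborel s = (\<integral>\<^sup>+t. s t \<partial>lborel)"
      using s(1) by (simp add: nn_integral_eq_simple_integral)
    also have "\<dots> = (\<integral>\<^sup>+t. s (c - t) \<partial>lborel)"
      by (subst nn_integral_real_affine[of _ "-1" c]) auto
    also have "\<dots> \<le> (\<integral>\<^sup>+t. f t \<partial>lborel)"
    proof (rule nn_integral_mono)
      fix t show "s (c - t) \<le> f t" using le_funD[OF s(2), of "c - t"] by simp
    qed
    finally show "integral\<^sup>S lborel s \<le> (\<integral>\<^sup>+t. f t \<partial>lborel)" .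
  qed
  show ?thesis
    using le[of f] le[of "\<lambda>t. f (c - t)"] by simp
qed

text \<open>Each simple function below \<open>f\<close> splits exactly along \<open>S\<close>, and
  its two parts lie below the corresponding parts of \<open>f\<close>.\<close>

lemma nn_integral_split_le:
  fixes f :: "'a \<Rightarrow> ennreal"
  assumes [measurable]: "S \<in> sets M"
  shows "(\<integral>\<^sup>+t. f t \<partial>M) \<le> (\<integral>\<^sup>+t\<in>S. f t \<partial>M) + (\<integral>\<^sup>+t\<in>-S. f t \<partial>M)"
  unfolding nn_integral_def[of M f]
proof (rule SUP_least, safe)
  fix s assume s: "simple_function M s" "s \<le> f"
  have [measurable]: "s \<in> borel_measurable M"
    using borel_measurable_simple_function[OF s(1)] .
  \<comment> \<open>\<open>- S\<close> is the complement in the whole type; on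
    \<open>space M\<close> it agrees with the measurable set \<open>space M - S\<close>.\<close>
  have [measurable]: "(\<lambda>t. s t * indicator (- S) t) \<in> borel_measurable M"
  proof -
    have "(\<lambda>t. s t * indicator (space M - S) t) \<in> borel_measurable M" by measurable
    then show ?thesis
      by (rule measurable_cong[THEN iffD1, rotated]) (auto split: split_indicator)
  qed
  have "integral\<^sup>S M s = (\<integral>\<^sup>+t. s t \<partial>M)"
    using s(1) by (simp add: nn_integral_eq_simple_integral)
  also have "\<dots> = (\<integral>\<^sup>+t. s t * indicator S t + s t * indicator (-S) t \<partial>M)"
    by (intro nn_integral_cong) (auto split: split_indicator)
  also have "\<dots> = (\<integral>\<^sup>+t\<in>S. s t \<partial>M) + (\<integral>\<^sup>+t\<in>-S. s t \<partial>M)"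
    by (rule nn_integral_add) auto
  also have "\<dots> \<le> (\<integral>\<^sup>+t\<in>S. f t \<partial>M) + (\<integral>\<^sup>+t\<in>-S. f t \<partial>M)"
    using le_funD[OF s(2)] by (intro add_mono nn_integral_mono mult_right_mono) auto
  finally show "integral\<^sup>S M s \<le> (\<integral>\<^sup>+t\<in>S. f t \<partial>M) + (\<integral>\<^sup>+t\<in>-S. f t \<partial>M)" .
qed

section \<open>Reflecting and joining curves\<close>

text \<open>Chain rule with inner derivative -1. On a nondegenerate interval the derivative within
  it is unique, so \<open>vector_derivative\<close> returns the computed value.\<close>

lemma C1_curve_on_reflect:
  assumes "C1_curve_on A \<gamma> a b" "a < b"
  shows "C1_curve_on A (\<lambda>t. \<gamma> (c - t)) (c - b) (c - a)"
  unfolding C1_curve_on_def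
proof (intro conjI ballI)
  have img: "(\<lambda>t. c - t) ` {c - b..c - a} = {a..b}"
    by simp
  show "continuous_on {c - b..c - a} (\<lambda>t. \<gamma> (c - t))"
  proof (rule continuous_on_compose2[of "{a..b}" \<gamma>])
    show "continuous_on {a..b} \<gamma>" using assms(1) unfolding C1_curve_on_def by blast
  qed (auto intro!: continuous_intros)
  fix C assume "C \<in> A"
  obtain U \<phi> where C: "C = (U, \<phi>)" by (cases C)
  let ?D = "\<lambda>t. vector_derivative (\<phi> \<circ> \<gamma>) (at t within {a..b})"
  from assms(1) \<open>C \<in> A\<close> C have diff: "\<And>t. t \<in> {a..b} \<Longrightarrow> \<gamma> t \<in> U \<Longrightarrow>
        ((\<phi> \<circ> \<gamma>) has_vector_derivative ?D t) (at t within {a..b})"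
    and cont: "continuous_on {t \<in> {a..b}. \<gamma> t \<in> U} ?D"
    unfolding C1_curve_on_def by (auto simp flip: vector_derivative_works)
  have deriv: "((\<phi> \<circ> (\<lambda>t. \<gamma> (c - t))) has_vector_derivative - ?D (c - t)) (at t within {c - b..c - a})"
    if "t \<in> {c - b..c - a}" "\<gamma> (c - t) \<in> U" for t
  proof -
    have "((\<phi> \<circ> \<gamma> \<circ> (\<lambda>t. c - t)) has_vector_derivative (-1) *\<^sub>R ?D (c - t)) (at t within {c - b..c - a})"
    proof (rule vector_diff_chain_within)
      show "((\<lambda>t. c - t) has_vector_derivative - 1) (at t within {c - b..c - a})"
        by (auto intro!: derivative_eq_intros simp: has_vector_derivative_def fun_eq_iff)
      show "((\<phi> \<circ> \<gamma>) has_vector_derivative ?D (c - t)) (at (c - t) within (\<lambda>t. c - t) ` {c - b..c - a})"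
        unfolding img using that by (intro diff) auto
    qed
    then show ?thesis by (simp add: o_def)
  qed
  have "continuous_on {t \<in> {c - b..c - a}. \<gamma> (c - t) \<in> U} (\<lambda>t. - ?D (c - t))"
    by (intro continuous_intros continuous_on_compose2[OF cont]) auto
  then have "continuous_on {t \<in> {c - b..c - a}. \<gamma> (c - t) \<in> U}
      (\<lambda>t. vector_derivative (\<phi> \<circ> (\<lambda>t. \<gamma> (c - t))) (at t within {c - b..c - a}))"
    using vector_derivative_within_closed_interval[OF _ _ deriv] assms(2)
    by (subst continuous_on_cong[OF refl]) auto
  moreover have "(\<phi> \<circ> (\<lambda>t. \<gamma> (c - t))) differentiable (at t within {c - b..c - a})"
    if "t \<in> {c - b..c - a}" "\<gamma> (c - t) \<in> U" for t
    using deriv[OF that] by (auto simp: differentiable_def has_vector_derivative_def)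
  ultimately show "case C of (U, \<phi>) \<Rightarrow>
      (\<forall>t\<in>{c - b..c - a}. \<gamma> (c - t) \<in> U \<longrightarrow>
          (\<phi> \<circ> (\<lambda>t. \<gamma> (c - t))) differentiable (at t within {c - b..c - a})) \<and>
      continuous_on {t \<in> {c - b..c - a}. \<gamma> (c - t) \<in> U}
        (\<lambda>t. vector_derivative (\<phi> \<circ> (\<lambda>t. \<gamma> (c - t))) (at t within {c - b..c - a}))"
    unfolding C by auto
qed

lemma piecewise_C1_curve_reflect:
  assumes "piecewise_C1_curve A \<gamma> a b"
  shows "piecewise_C1_curve A (\<lambda>t. \<gamma> (c - t)) (c - b) (c - a)"
proof -
  from assms obtain S where S: "finite S"
    "\<And>s t. a \<le> s \<Longrightarrow> s < t \<Longrightarrow> t \<le> b \<Longrightarrow> {s<..<t} \<inter> S = {} \<Longrightarrow> C1_curve_on A \<gamma> s t"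
    and cont: "continuous_on {a..b} \<gamma>"
    unfolding piecewise_C1_curve_def by blast
  have "C1_curve_on A (\<lambda>t. \<gamma> (c - t)) s t"
    if st: "c - b \<le> s" "s < t" "t \<le> c - a" "{s<..<t} \<inter> (\<lambda>t. c - t) ` S = {}" for s t
  proof -
    have "{c - t<..<c - s} \<inter> S = {}"
    proof (rule ccontr)
      assume "{c - t<..<c - s} \<inter> S \<noteq> {}"
      then obtain u where "u \<in> S" "c - t < u" "u < c - s" by auto
      then have "c - u \<in> {s<..<t} \<inter> (\<lambda>t. c - t) ` S" by auto
      with st(4) show False by blast
    qed
    then have "C1_curve_on A \<gamma> (c - t) (c - s)"
      using st by (intro S(2)) auto
    from C1_curve_on_reflect[OF this, of c] show ?thesis using st by simp
  qed
  moreover have "continuous_on {c - b..c - a} (\<lambda>t. \<gamma> (c - t))"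
    by (intro continuous_on_compose2[OF cont]) (auto intro!: continuous_intros)
  ultimately show ?thesis
    unfolding piecewise_C1_curve_def using S(1)
    by (intro conjI exI[of _ "(\<lambda>t. c - t) ` S"] allI impI) (blast | simp)+
qed

text \<open>\<open>speed\<close> uses two-sided derivatives, whereas a C1 piece provides derivatives
  within its interval. A point that is no break point is interior to a small closed interval free of
  break points, and there both notions coincide.\<close>

lemma piecewise_C1_curve_differentiable:
  assumes "piecewise_C1_curve A \<gamma> a b"
  obtains S where "finite S"
    "\<And>t U \<phi>. a < t \<Longrightarrow> t < b \<Longrightarrow> t \<notin> S \<Longrightarrow> (U, \<phi>) \<in> A \<Longrightarrow> \<gamma> t \<in> U \<Longrightarrow> (\<phi> \<circ> \<gamma>) differentiable (at t)"
proof -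
  from assms obtain S where S: "finite S"
    "\<And>s t. a \<le> s \<Longrightarrow> s < t \<Longrightarrow> t \<le> b \<Longrightarrow> {s<..<t} \<inter> S = {} \<Longrightarrow> C1_curve_on A \<gamma> s t"
    unfolding piecewise_C1_curve_def by blast
  have "(\<phi> \<circ> \<gamma>) differentiable (at t)"
    if t: "a < t" "t < b" "t \<notin> S" "(U, \<phi>) \<in> A" "\<gamma> t \<in> U" for t U \<phi>
  proof -
    have "open ({a<..<b} - S)"
      using S(1) by (intro open_Diff finite_imp_closed) auto
    moreover have "t \<in> {a<..<b} - S" using t by simp
    ultimately obtain e where e: "e > 0" "cball t e \<subseteq> {a<..<b} - S"
      unfolding open_contains_cball by blast
    have "t - e \<in> {a<..<b} - S" "t + e \<in> {a<..<b} - S"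
      by (rule subsetD[OF e(2)], use e(1) in \<open>simp add: dist_real_def\<close>)+
    then have "a < t - e" "t + e < b" by auto
    moreover have "{t - e<..<t + e} \<inter> S = {}"
    proof -
      have "{t - e<..<t + e} \<subseteq> cball t e" by (auto simp: dist_real_def)
      with e(2) show ?thesis by blast
    qed
    ultimately have "C1_curve_on A \<gamma> (t - e) (t + e)"
      using e(1) by (intro S(2)) auto
    then have "(\<phi> \<circ> \<gamma>) differentiable (at t within {t - e..t + e})"
      unfolding C1_curve_on_def using t e(1) by fastforce
    moreover have "at t within {t - e..t + e} = at t"
      using e(1) by (intro at_within_interior) simp
    ultimately show ?thesis by simp
  qed
  with S(1) show ?thesis using that by blast
qed

lemma smooth_atlas_chart_ex:
  assumes "smooth_atlas A"
  obtains U \<phi> where "(U, \<phi>) \<in> A" "x \<in> U"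
  using assms unfolding smooth_atlas_def by blast

text \<open>The chart chosen inside \<open>speed\<close> depends only on the point
  \<open>\<gamma> t\<close>. Hence one chart serves all curves through \<open>x\<close>, and their
  speeds there can be compared without changing coordinates.\<close>

lemma speed_chart_ex:
  assumes "smooth_atlas A"
  obtains U \<phi> where "(U, \<phi>) \<in> A" "x \<in> U"
    "\<And>\<gamma> t. \<gamma> t = x \<Longrightarrow>
       speed A g \<gamma> t = sqrt (g (U, \<phi>) x (vector_derivative (\<phi> \<circ> \<gamma>) (at t)) (vector_derivative (\<phi> \<circ> \<gamma>) (at t)))"
proof -
  obtain U \<phi> where c: "(SOME c. c \<in> A \<and> x \<in> fst c) = (U, \<phi>)" by fastforce
  have "\<exists>c. c \<in> A \<and> x \<in> fst c"
    using smooth_atlas_chart_ex[OF assms, of x] by (metis fst_conv)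
  from someI_ex[OF this] have "(U, \<phi>) \<in> A" "x \<in> U" unfolding c by auto
  then show ?thesis
    by (rule that) (simp add: speed_def c Let_def)
qed

text \<open>Reversal negates the velocity, and the two signs cancel in the bilinear form.\<close>

lemma speed_reflect:
  assumes "smooth_atlas A" "riemannian_metric A g"
    and diff: "\<And>U \<phi>. (U, \<phi>) \<in> A \<Longrightarrow> \<gamma> (c - t) \<in> U \<Longrightarrow> (\<phi> \<circ> \<gamma>) differentiable (at (c - t))"
  shows "speed A g (\<lambda>t. \<gamma> (c - t)) t = speed A g \<gamma> (c - t)"
proof -
  obtain U \<phi> where U: "(U, \<phi>) \<in> A" "\<gamma> (c - t) \<in> U"
    and speed: "\<And>\<eta> s. \<eta> s = \<gamma> (c - t) \<Longrightarrow> speed A g \<eta> s =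
      sqrt (g (U, \<phi>) (\<gamma> (c - t)) (vector_derivative (\<phi> \<circ> \<eta>) (at s)) (vector_derivative (\<phi> \<circ> \<eta>) (at s)))"
    using speed_chart_ex[OF assms(1), of "\<gamma> (c - t)"] by metis
  let ?v = "vector_derivative (\<phi> \<circ> \<gamma>) (at (c - t))"
  have "((\<phi> \<circ> \<gamma> \<circ> (\<lambda>t. c - t)) has_vector_derivative (-1) *\<^sub>R ?v) (at t)"
  proof (rule vector_diff_chain_at)
    show "((\<lambda>t. c - t) has_vector_derivative - 1) (at t)"
      by (auto intro!: derivative_eq_intros simp: has_vector_derivative_def fun_eq_iff)
    show "((\<phi> \<circ> \<gamma>) has_vector_derivative ?v) (at (c - t))"
      using diff[OF U] by (simp add: vector_derivative_works)
  qed
  then have "vector_derivative (\<phi> \<circ> (\<lambda>t. \<gamma> (c - t))) (at t) = - ?v"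
    by (auto simp: o_def dest: vector_derivative_at)
  moreover have "bilinear (g (U, \<phi>) (\<gamma> (c - t)))"
    using assms(2) U unfolding riemannian_metric_def by fast
  ultimately show ?thesis
    using speed[of "\<lambda>t. \<gamma> (c - t)" t] speed[of \<gamma> "c - t"]
    by (simp add: bilinear_lneg bilinear_rneg)
qed

lemma AE_lborel_finite:
  fixes S :: "'a::euclidean_space set"
  assumes "finite S"
  shows "AE t in lborel. t \<notin> S"
  using assms by (intro AE_not_in finite_imp_null_set_lborel)

lemma curve_length_reflect_le:
  assumes "smooth_atlas A" "riemannian_metric A g" "piecewise_C1_curve A \<gamma> a b"
  shows "curve_length A g (\<lambda>t. \<gamma> (c - t)) (c - b) (c - a) \<le> curve_length A g \<gamma> a b"
proof -
  obtain S where S: "finite S"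
    "\<And>t U \<phi>. a < t \<Longrightarrow> t < b \<Longrightarrow> t \<notin> S \<Longrightarrow> (U, \<phi>) \<in> A \<Longrightarrow> \<gamma> t \<in> U \<Longrightarrow> (\<phi> \<circ> \<gamma>) differentiable (at t)"
    using piecewise_C1_curve_differentiable[OF assms(3)] by blast
  \<comment> \<open>The end points join the exceptional set because differentiability is known only
    inside the open interval; the set stays finite, hence null.\<close>
  let ?N = "(\<lambda>t. c - t) ` (insert a (insert b S))"
  have "AE t in lborel. t \<notin> ?N"
    using S(1) by (intro AE_lborel_finite) auto
  then have "AE t in lborel.
      ennreal (speed A g (\<lambda>t. \<gamma> (c - t)) t) * indicator {c - b..c - a} t \<le>
      ennreal (speed A g \<gamma> (c - t)) * indicator {a..b} (c - t)"
  proof eventually_elim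
    case (elim t)
    show ?case
    proof (cases "t \<in> {c - b..c - a}")
      case True
      have "c - t \<notin> insert a (insert b S)"
      proof
        assume "c - t \<in> insert a (insert b S)"
        then have "c - (c - t) \<in> ?N" by blast
        with elim show False by simp
      qed
      then have "speed A g (\<lambda>t. \<gamma> (c - t)) t = speed A g \<gamma> (c - t)"
        using True by (intro speed_reflect assms S(2)) auto
      then show ?thesis using True by simp
    qed simp
  qed
  then have "curve_length A g (\<lambda>t. \<gamma> (c - t)) (c - b) (c - a) \<le>
      (\<integral>\<^sup>+t. ennreal (speed A g \<gamma> (c - t)) * indicator {a..b} (c - t) \<partial>lborel)"
    unfolding curve_length_def by (rule nn_integral_mono_AE)
  also have "\<dots> = curve_length A g \<gamma> a b"
    unfolding curve_length_def by (rule nn_integral_lborel_reflect)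
  finally show ?thesis .
qed

text \<open>Derivatives within \<open>{s..t}\<close> see only values on \<open>{s..t}\<close>, so
  the curves may separate immediately beyond an end point. This is the situation at a
  junction.\<close>

lemma C1_curve_on_cong:
  assumes "C1_curve_on A \<gamma> s t" "\<And>u. u \<in> {s..t} \<Longrightarrow> \<eta> u = \<gamma> u"
  shows "C1_curve_on A \<eta> s t"
proof -
  have vd: "vector_derivative (\<phi> \<circ> \<eta>) (at u within {s..t}) = vector_derivative (\<phi> \<circ> \<gamma>) (at u within {s..t})"
    if "u \<in> {s..t}" for u and \<phi> :: "'a \<Rightarrow> real ^ 'b"
    using that assms(2) by (intro vector_derivative_cong_eq always_eventually) auto
  have diff: "(\<phi> \<circ> \<eta>) differentiable (at u within {s..t})"
    if "u \<in> {s..t}" "(\<phi> \<circ> \<gamma>) differentiable (at u within {s..t})" for u and \<phi> :: "'a \<Rightarrow> real ^ 'b"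
    using that assms(2)
    by (intro differentiable_transform_within[OF that(2), of 1]) auto
  show ?thesis
    unfolding C1_curve_on_def
  proof (intro conjI ballI case_prodI2 impI)
    show "continuous_on {s..t} \<eta>"
      using assms continuous_on_cong[of "{s..t}" "{s..t}" \<eta> \<gamma>] unfolding C1_curve_on_def by auto
  next
    fix C U \<phi> assume C: "C \<in> A" "C = (U, \<phi>)"
    have "continuous_on {u \<in> {s..t}. \<gamma> u \<in> U} (\<lambda>u. vector_derivative (\<phi> \<circ> \<gamma>) (at u within {s..t}))"
      using assms(1) C unfolding C1_curve_on_def by fast
    then show "continuous_on {u \<in> {s..t}. \<eta> u \<in> U} (\<lambda>u. vector_derivative (\<phi> \<circ> \<eta>) (at u within {s..t}))"
      by (rule continuous_on_cong[THEN iffD1, rotated 2]) (use assms(2) vd in auto)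
    fix u assume u: "u \<in> {s..t}" "\<eta> u \<in> U"
    show "(\<phi> \<circ> \<eta>) differentiable (at u within {s..t})"
    proof (rule diff[OF u(1)])
      show "(\<phi> \<circ> \<gamma>) differentiable (at u within {s..t})"
        using assms C u unfolding C1_curve_on_def by fastforce
    qed
  qed
qed

lemma piecewise_C1_curve_join:
  assumes "piecewise_C1_curve A \<gamma> a b" "piecewise_C1_curve A \<eta> b d" "\<gamma> b = \<eta> b" "a \<le> b" "b \<le> d"
  shows "piecewise_C1_curve A (\<lambda>t. if t \<le> b then \<gamma> t else \<eta> t) a d"
proof -
  let ?\<delta> = "\<lambda>t. if t \<le> b then \<gamma> t else \<eta> t"
  obtain S where S: "finite S"
    "\<And>s t. a \<le> s \<Longrightarrow> s < t \<Longrightarrow> t \<le> b \<Longrightarrow> {s<..<t} \<inter> S = {} \<Longrightarrow> C1_curve_on A \<gamma> s t"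
    and cont\<gamma>: "continuous_on {a..b} \<gamma>"
    using assms(1) unfolding piecewise_C1_curve_def by blast
  obtain T where T: "finite T"
    "\<And>s t. b \<le> s \<Longrightarrow> s < t \<Longrightarrow> t \<le> d \<Longrightarrow> {s<..<t} \<inter> T = {} \<Longrightarrow> C1_curve_on A \<eta> s t"
    and cont\<eta>: "continuous_on {b..d} \<eta>"
    using assms(2) unfolding piecewise_C1_curve_def by blast
  have "continuous_on ({a..b} \<union> {b..d}) ?\<delta>"
    using cont\<gamma> cont\<eta> assms(3) by (intro continuous_on_If) auto
  then have "continuous_on {a..d} ?\<delta>"
    using assms(4,5) by (simp add: ivl_disj_un_two_touch)
  moreover have "C1_curve_on A ?\<delta> s t"
    if "a \<le> s" "s < t" "t \<le> d" "{s<..<t} \<inter> insert b (S \<union> T) = {}" for s t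
  proof -
    \<comment> \<open>The junction \<open>b\<close> counts as a break point, so an interval free of
      break points lies on one side of it.\<close>
    have "t \<le> b \<or> b \<le> s" using that by force
    then show ?thesis
    proof
      assume "t \<le> b"
      with that show ?thesis by (intro C1_curve_on_cong[OF S(2)]) auto
    next
      assume "b \<le> s"
      then have "C1_curve_on A \<eta> s t" using that by (intro T(2)) auto
      moreover have "?\<delta> u = \<eta> u" if "u \<in> {s..t}" for u
        using that \<open>b \<le> s\<close> assms(3) by (cases "u = b") auto
      ultimately show ?thesis by (rule C1_curve_on_cong)
    qed
  qed
  ultimately show ?thesis
    unfolding piecewise_C1_curve_def using S(1) T(1)
    by (intro conjI exI[of _ "insert b (S \<union> T)"] allI impI) (blast | simp)+
qed

lemma speed_cong:
  assumes "eventually (\<lambda>s. \<eta> s = \<gamma> s) (nhds t)"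
  shows "speed A g \<eta> t = speed A g \<gamma> t"
proof -
  have "\<eta> t = \<gamma> t" using assms by (rule eventually_nhds_x_imp_x)
  moreover have "vector_derivative (\<phi> \<circ> \<eta>) (at t) = vector_derivative (\<phi> \<circ> \<gamma>) (at t)"
    for \<phi> :: "'a \<Rightarrow> real ^ 'b"
    using assms by (intro vector_derivative_cong_eq) (auto elim: eventually_mono)
  ultimately show ?thesis unfolding speed_def by simp
qed

text \<open>Away from \<open>b\<close> the joined curve coincides near each parameter with one of
  the two curves, so the speeds agree there; the single parameter \<open>b\<close> is null.\<close>

lemma curve_length_join_le:
  assumes "a \<le> b" "b \<le> d"
  shows "curve_length A g (\<lambda>t. if t \<le> b then \<gamma> t else \<eta> t) a d \<le>
    curve_length A g \<gamma> a b + curve_length A g \<eta> b d"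
proof -
  let ?\<delta> = "\<lambda>t. if t \<le> b then \<gamma> t else \<eta> t"
  let ?f = "\<lambda>t. ennreal (speed A g ?\<delta> t) * indicator {a..d} t"
  have sp: "speed A g ?\<delta> t = (if t < b then speed A g \<gamma> t else speed A g \<eta> t)" if "t \<noteq> b" for t
  proof (cases "t < b")
    case True
    then have "eventually (\<lambda>s. s < b) (nhds t)"
      by (intro eventually_nhds_in_open[of "{..<b}", simplified])
    then have "speed A g ?\<delta> t = speed A g \<gamma> t"
      by (intro speed_cong) (auto elim: eventually_mono)
    then show ?thesis using True by simp
  next
    case False
    then have "eventually (\<lambda>s. b < s) (nhds t)"
      using that by (intro eventually_nhds_in_open[of "{b<..}", simplified]) auto
    then have "speed A g ?\<delta> t = speed A g \<eta> t"
      by (intro speed_cong) (auto elim: eventually_mono)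
    then show ?thesis using False by simp
  qed
  have ae: "AE t in lborel. t \<noteq> b"
    using AE_lborel_finite[of "{b}"] by simp
  have "curve_length A g ?\<delta> a d \<le> (\<integral>\<^sup>+t\<in>{..b}. ?f t \<partial>lborel) + (\<integral>\<^sup>+t\<in>-{..b}. ?f t \<partial>lborel)"
    unfolding curve_length_def by (rule nn_integral_split_le) simp
  also have "(\<integral>\<^sup>+t\<in>{..b}. ?f t \<partial>lborel) \<le> curve_length A g \<gamma> a b"
    unfolding curve_length_def
    by (rule nn_integral_mono_AE, use ae in eventually_elim)
       (auto simp: sp split: split_indicator)
  also have "(\<integral>\<^sup>+t\<in>-{..b}. ?f t \<partial>lborel) \<le> curve_length A g \<eta> b d"
    unfolding curve_length_def
    by (rule nn_integral_mono_AE, use ae in eventually_elim)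
       (auto simp: sp split: split_indicator)
  finally show ?thesis by (simp add: add_mono)
qed

text \<open>Triangle inequality and symmetry in one: the curve from \<open>z\<close> to
  \<open>y\<close> is run backwards after the curve from \<open>x\<close> to \<open>y\<close>.
  Strict hypotheses yield actual curves even where the infimum is not attained.\<close>

lemma riem_dist_less_add:
  assumes "smooth_atlas A" "riemannian_metric A g"
    and "riem_dist A g x y < e" "riem_dist A g z y < f"
  shows "riem_dist A g x z < e + f"
proof -
  obtain \<gamma> a b where \<gamma>: "a \<le> b" "piecewise_C1_curve A \<gamma> a b" "\<gamma> a = x" "\<gamma> b = y"
    and \<gamma>l: "curve_length A g \<gamma> a b < e"
    using assms(3) unfolding riem_dist_def Inf_less_iff by blast
  obtain \<eta> a' b' where \<eta>: "a' \<le> b'" "piecewise_C1_curve A \<eta> a' b'" "\<eta> a' = z" "\<eta> b' = y"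
    and \<eta>l: "curve_length A g \<eta> a' b' < f"
    using assms(4) unfolding riem_dist_def Inf_less_iff by blast
  \<comment> \<open>The reflection \<open>t \<mapsto> c - t\<close> must send \<open>b\<close> to
    \<open>b'\<close>, so that the reversed curve starts at the time \<open>b\<close> at which the
    first one ends; it runs until \<open>d\<close>.\<close>
  define c where "c = b + b'"
  define d where "d = c - a'"
  let ?\<eta> = "\<lambda>t. \<eta> (c - t)"
  let ?\<delta> = "\<lambda>t. if t \<le> b then \<gamma> t else ?\<eta> t"
  have cb: "c - b' = b" by (simp add: c_def)
  have bd: "b \<le> d" using \<eta>(1) by (simp add: c_def d_def)
  have pw: "piecewise_C1_curve A ?\<eta> b d"
    using piecewise_C1_curve_reflect[OF \<eta>(2), of c] by (simp add: cb d_def)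
  have "piecewise_C1_curve A ?\<delta> a d"
    using \<gamma> \<eta> pw bd by (intro piecewise_C1_curve_join) (auto simp: c_def)
  moreover have "?\<delta> a = x" "?\<delta> d = z" "a \<le> d"
    using \<gamma> \<eta> bd by (auto simp: d_def c_def)
  ultimately have "riem_dist A g x z \<le> curve_length A g ?\<delta> a d"
    unfolding riem_dist_def
    by (intro Inf_lower CollectI exI[of _ "?\<delta>"] exI[of _ a] exI[of _ d] conjI refl)
  also have "\<dots> \<le> curve_length A g \<gamma> a b + curve_length A g ?\<eta> b d"
    using \<gamma>(1) bd by (rule curve_length_join_le)
  also have "\<dots> \<le> curve_length A g \<gamma> a b + curve_length A g \<eta> a' b'"
    using curve_length_reflect_le[OF assms(1,2) \<eta>(2), of c]
    by (intro add_left_mono) (simp add: cb d_def)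
  also have "\<dots> < e + f"
    using \<gamma>l \<eta>l by (rule add_strict_mono)
  finally show ?thesis .
qed

section \<open>Positivity of the volume density\<close>

lemma bilinear_expansion_cart:
  fixes h :: "real ^ 'n \<Rightarrow> real ^ 'n \<Rightarrow> real"
  assumes "bilinear h"
  shows "h v w = (\<Sum>i\<in>UNIV. \<Sum>j\<in>UNIV. v $ i * w $ j * h (axis i 1) (axis j 1))"
proof -
  have "h v w = h (\<Sum>i\<in>UNIV. v $ i *\<^sub>R axis i 1) (\<Sum>j\<in>UNIV. w $ j *\<^sub>R axis j 1)"
    by (simp add: basis_expansion flip: scalar_mult_eq_scaleR)
  also have "\<dots> = (\<Sum>(i, j)\<in>UNIV \<times> UNIV. h (v $ i *\<^sub>R axis i 1) (w $ j *\<^sub>R axis j 1))"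
    by (rule bilinear_sum[OF assms])
  also have "\<dots> = (\<Sum>(i, j)\<in>UNIV \<times> UNIV. v $ i * w $ j * h (axis i 1) (axis j 1))"
    by (intro sum.cong) (auto simp: bilinear_lmul[OF assms] bilinear_rmul[OF assms])
  finally show ?thesis by (simp add: sum.cartesian_product)
qed

lemma continuous_on_det:
  fixes M :: "'a::topological_space \<Rightarrow> real ^ 'n ^ 'n"
  assumes "\<And>i j. continuous_on S (\<lambda>x. M x $ i $ j)"
  shows "continuous_on S (\<lambda>x. det (M x))"
  unfolding det_def by (intro continuous_intros assms)

text \<open>The determinant does not vanish on the segment from the identity to \<open>M\<close>.\<close>

lemma det_positive_definite:
  fixes M :: "real ^ 'n ^ 'n"
  assumes "\<And>v. v \<noteq> 0 \<Longrightarrow> v \<bullet> (M *v v) > 0"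
  shows "det M > 0"
proof (rule ccontr)
  assume "\<not> det M > 0"
  let ?N = "\<lambda>t. (1 - t) *\<^sub>R mat 1 + t *\<^sub>R M"
  have "\<exists>t\<ge>0. t \<le> 1 \<and> det (?N t) = 0"
    by (rule IVT2') (use \<open>\<not> det M > 0\<close> in \<open>auto intro!: continuous_on_det continuous_intros\<close>)
  then obtain t where t: "0 \<le> t" "t \<le> 1" "det (?N t) = 0" by blast
  then have "\<not> invertible (?N t)" by (simp add: invertible_det_nz)
  then obtain v where v: "v \<noteq> 0" "?N t *v v = 0"
    using matrix_left_invertible_ker[of "?N t"] by (auto simp: invertible_left_inverse)
  have "0 = v \<bullet> (?N t *v v)" using v(2) by simp
  also have "\<dots> = (1 - t) * (v \<bullet> v) + t * (v \<bullet> (M *v v))"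
    by (simp add: matrix_vector_mult_add_rdistrib scaleR_matrix_vector_assoc[symmetric] inner_add_right)
  also have "\<dots> > 0"
    using assms[OF v(1)] t v(1)
    by (cases "t = 1") (auto intro!: add_pos_nonneg mult_pos_pos)
  finally show False by simp
qed

text \<open>Carries positive definiteness of the metric over to the matrix whose determinant occurs
  in \<open>volume_density\<close>.\<close>

lemma inner_gram_matrix:
  fixes h :: "real ^ 'n \<Rightarrow> real ^ 'n \<Rightarrow> real"
  assumes "bilinear h"
  shows "v \<bullet> ((\<chi> i j. h (axis i 1) (axis j 1)) *v v) = h v v"
  by (subst bilinear_expansion_cart[OF assms])
     (simp add: inner_vec_def matrix_vector_mult_def sum_distrib_left mult_ac)

lemma volume_density_pos:
  assumes "riemannian_metric A g" "(U, \<phi>) \<in> A" "x \<in> U"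
  shows "volume_density g (U, \<phi>) x > 0"
proof -
  have "bilinear (g (U, \<phi>) x)" and pos: "\<And>v. v \<noteq> 0 \<Longrightarrow> g (U, \<phi>) x v v > 0"
    using assms unfolding riemannian_metric_def by fast+
  from inner_gram_matrix[OF this(1)] pos
  have "det (\<chi> i j. g (U, \<phi>) x (axis i 1) (axis j 1)) > 0"
    by (intro det_positive_definite) simp
  then show ?thesis unfolding volume_density_def by simp
qed

section \<open>Charts near a point\<close>

lemma smooth_atlas_chartD:
  assumes "smooth_atlas A" "(U, \<phi>) \<in> A"
  shows "open U" "open (\<phi> ` U)" "continuous_on U \<phi>" "continuous_on (\<phi> ` U) (inv_into U \<phi>)"
    and "\<And>x. x \<in> U \<Longrightarrow> inv_into U \<phi> (\<phi> x) = x"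
  using assms unfolding smooth_atlas_def is_chart_def homeomorphism_def by fast+

lemma riemannian_metric_continuous:
  assumes "riemannian_metric A g" "(U, \<phi>) \<in> A"
  shows "continuous_on (\<phi> ` U) (\<lambda>y. g (U, \<phi>) (inv_into U \<phi> y) v w)"
proof -
  have "smooth_on (\<lambda>y. g (U, \<phi>) (inv_into U \<phi> y) v w) (\<phi> ` U)"
    using assms unfolding riemannian_metric_def by fast
  then show ?thesis unfolding smooth_on_def by (metis Ck_on.simps(1))
qed

lemma riemannian_metric_transform:
  assumes "riemannian_metric A g" "(U, \<phi>) \<in> A" "(U', \<psi>) \<in> A" "x \<in> U \<inter> U'"
  defines "D \<equiv> frechet_derivative (\<psi> \<circ> inv_into U \<phi>) (at (\<phi> x))"
  shows "g (U, \<phi>) x v w = g (U', \<psi>) x (D v) (D w)"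
proof -
  have "\<forall>(U, \<phi>)\<in>A. \<forall>(U', \<psi>)\<in>A. \<forall>x\<in>U \<inter> U'. \<forall>v w.
      let D = frechet_derivative (\<psi> \<circ> inv_into U \<phi>) (at (\<phi> x))
      in g (U, \<phi>) x v w = g (U', \<psi>) x (D v) (D w)"
    using assms(1) unfolding riemannian_metric_def by (elim conjE)
  from bspec[OF this assms(2)] have "\<forall>(U', \<psi>)\<in>A. \<forall>x\<in>U \<inter> U'. \<forall>v w.
      let D = frechet_derivative (\<psi> \<circ> inv_into U \<phi>) (at (\<phi> x))
      in g (U, \<phi>) x v w = g (U', \<psi>) x (D v) (D w)"
    by simp
  from bspec[OF this assms(3)] show ?thesis
    using assms(4) by (simp add: D_def Let_def)
qed

lemma chart_ball_open:
  assumes "smooth_atlas A" "(U, \<phi>) \<in> A"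
  shows "open (U \<inter> \<phi> -` ball z \<delta>)"
  using smooth_atlas_chartD[OF assms] by (metis continuous_on_open_vimage open_ball Int_commute)

text \<open>In coordinates the volume is the integral of a continuous positive density, which stays
  above a positive constant on some smaller Euclidean ball.\<close>

lemma emeasure_volume_chart_ball_pos:
  fixes \<phi> :: "'a::topological_space \<Rightarrow> real ^ 'n"
  assumes "smooth_atlas A" "riemannian_metric A g" "is_riemannian_volume A g V"
    and U: "(U, \<phi>) \<in> A" "p \<in> U" and \<delta>: "\<delta> > 0" "ball (\<phi> p) \<delta> \<subseteq> \<phi> ` U"
  shows "emeasure V (U \<inter> \<phi> -` ball (\<phi> p) \<delta>) > 0"
proof -
  note chart = smooth_atlas_chartD[OF assms(1) U(1)]
  let ?O = "U \<inter> \<phi> -` ball (\<phi> p) \<delta>"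
  let ?\<rho> = "\<lambda>y. volume_density g (U, \<phi>) (inv_into U \<phi> y)"
  have "?O \<in> sets borel"
    using chart_ball_open[OF assms(1) U(1)] by (rule borel_open)
  then have "emeasure V ?O = (\<integral>\<^sup>+y\<in>\<phi> ` ?O. ennreal (?\<rho> y) \<partial>lborel)"
    using assms(3) U(1) unfolding is_riemannian_volume_def by fast
  also have "\<phi> ` ?O = ball (\<phi> p) \<delta>" using \<delta>(2) by auto
  finally have V: "emeasure V ?O = (\<integral>\<^sup>+y\<in>ball (\<phi> p) \<delta>. ennreal (?\<rho> y) \<partial>lborel)" .
  \<comment> \<open>Half the central density is positive and strictly below the central value, so
    \<open>{k<..}\<close> pulls back to an open set containing the centre.\<close>
  define k where "k = ?\<rho> (\<phi> p) / 2"
  have k: "k > 0" "k < ?\<rho> (\<phi> p)"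
    using volume_density_pos[OF assms(2) U] chart(5)[OF U(2)] by (auto simp: k_def)
  have "continuous_on (\<phi> ` U) ?\<rho>"
    unfolding volume_density_def
    by (intro continuous_on_real_sqrt continuous_on_det)
       (simp add: riemannian_metric_continuous[OF assms(2) U(1)])
  then have "continuous_on (ball (\<phi> p) \<delta>) ?\<rho>"
    using \<delta>(2) by (rule continuous_on_subset)
  then have "open (ball (\<phi> p) \<delta> \<inter> ?\<rho> -` {k<..})"
    by (rule continuous_open_preimage) auto
  moreover have "\<phi> p \<in> ball (\<phi> p) \<delta> \<inter> ?\<rho> -` {k<..}"
    using k \<delta>(1) by simp
  ultimately obtain e where e: "e > 0" "ball (\<phi> p) e \<subseteq> ball (\<phi> p) \<delta> \<inter> ?\<rho> -` {k<..}"
    unfolding open_contains_ball by blast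
  have "emeasure lborel (ball (\<phi> p) e) > 0"
    using content_ball_pos[OF e(1), of "\<phi> p"] by (simp add: measure_def enn2real_positive_iff)
  then have "0 < ennreal k * emeasure lborel (ball (\<phi> p) e)"
    using k by (simp add: ennreal_zero_less_mult_iff)
  also have "\<dots> = (\<integral>\<^sup>+y. ennreal k * indicator (ball (\<phi> p) e) y \<partial>lborel)"
    by (simp add: nn_integral_cmult_indicator)
  also have "\<dots> \<le> (\<integral>\<^sup>+y\<in>ball (\<phi> p) \<delta>. ennreal (?\<rho> y) \<partial>lborel)"
  proof (rule nn_integral_mono)
    fix y
    show "ennreal k * indicator (ball (\<phi> p) e) y \<le> ennreal (?\<rho> y) * indicator (ball (\<phi> p) \<delta>) y"
    proof (cases "y \<in> ball (\<phi> p) e")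
      case True
      with e(2) have "y \<in> ball (\<phi> p) \<delta>" "k < ?\<rho> y" by auto
      with True show ?thesis by (simp add: ennreal_leI)
    qed simp
  qed
  finally show ?thesis unfolding V .
qed

section \<open>Straight coordinate segments as curves\<close>

lemma segment_has_vector_derivative:
  fixes A :: "('a::topological_space, 'n::finite) chart set"
  assumes "smooth_atlas A" "(U, \<phi>) \<in> A" "(U', \<psi>) \<in> A"
    and "z + t *\<^sub>R v \<in> \<phi> ` U" "inv_into U \<phi> (z + t *\<^sub>R v) \<in> U'"
  shows "((\<psi> \<circ> (\<lambda>t. inv_into U \<phi> (z + t *\<^sub>R v))) has_vector_derivative
      frechet_derivative (\<psi> \<circ> inv_into U \<phi>) (at (z + t *\<^sub>R v)) v) (at t)"
    and "z + t *\<^sub>R v \<in> \<phi> ` (U \<inter> U')"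
proof -
  note chart = smooth_atlas_chartD[OF assms(1,2)]
  show mem: "z + t *\<^sub>R v \<in> \<phi> ` (U \<inter> U')"
    using assms(4,5) chart(5) by force
  have "smooth_on (\<psi> \<circ> inv_into U \<phi>) (\<phi> ` (U \<inter> U'))"
    using assms(1-3) unfolding smooth_atlas_def by fast
  then have "Ck_on (Suc 0) (\<psi> \<circ> inv_into U \<phi>) (\<phi> ` (U \<inter> U'))"
    unfolding smooth_on_def by blast
  with mem have "(\<psi> \<circ> inv_into U \<phi>) differentiable (at (z + t *\<^sub>R v))"
    by auto
  then have D: "((\<psi> \<circ> inv_into U \<phi>) has_derivative
      frechet_derivative (\<psi> \<circ> inv_into U \<phi>) (at (z + t *\<^sub>R v))) (at (z + t *\<^sub>R v))"
    by (simp add: frechet_derivative_works)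
  have "((\<lambda>t. z + t *\<^sub>R v) has_vector_derivative v) (at t)"
    by (auto intro!: derivative_eq_intros simp: has_vector_derivative_def)
  from vector_derivative_diff_chain_within[OF this has_derivative_at_withinI[OF D]]
  show "((\<psi> \<circ> (\<lambda>t. inv_into U \<phi> (z + t *\<^sub>R v))) has_vector_derivative
      frechet_derivative (\<psi> \<circ> inv_into U \<phi>) (at (z + t *\<^sub>R v)) v) (at t)"
    by (simp add: o_def)
qed

text \<open>In any other chart the segment is a transition map applied to an affine curve. Its
  derivative is the directional derivative of that map along \<open>v\<close>, which is continuous
  since the map is C1.\<close>

lemma segment_C1_curve_on:
  fixes A :: "('a::topological_space, 'n::finite) chart set"
  assumes A: "smooth_atlas A" "(U, \<phi>) \<in> A"
    and seg: "\<And>t. t \<in> {a..b} \<Longrightarrow> z + t *\<^sub>R v \<in> \<phi> ` U" and "a < b"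
  shows "C1_curve_on A (\<lambda>t. inv_into U \<phi> (z + t *\<^sub>R v)) a b"
  unfolding C1_curve_on_def
proof (intro conjI ballI case_prodI2 impI)
  let ?\<gamma> = "\<lambda>t. inv_into U \<phi> (z + t *\<^sub>R v)"
  show "continuous_on {a..b} ?\<gamma>"
    by (rule continuous_on_compose2[OF smooth_atlas_chartD(4)[OF A]])
       (use seg in \<open>auto intro!: continuous_intros\<close>)
  fix C U' \<psi> assume "C \<in> A" "C = (U', \<psi>)"
  then have U': "(U', \<psi>) \<in> A" by simp
  let ?F = "\<psi> \<circ> inv_into U \<phi>"
  note deriv = segment_has_vector_derivative[OF A U' seg]
  show "(\<psi> \<circ> ?\<gamma>) differentiable (at t within {a..b})" if "t \<in> {a..b}" "?\<gamma> t \<in> U'" for t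
    using deriv(1)[OF that] differentiable_at_withinI differentiableI_vector by blast
  have "smooth_on ?F (\<phi> ` (U \<inter> U'))"
    using A U' unfolding smooth_atlas_def by fast
  then have "Ck_on (Suc 0) ?F (\<phi> ` (U \<inter> U'))"
    unfolding smooth_on_def by blast
  then have "continuous_on (\<phi> ` (U \<inter> U')) (\<lambda>y. frechet_derivative ?F (at y) v)"
    by simp
  then have "continuous_on {t \<in> {a..b}. ?\<gamma> t \<in> U'} (\<lambda>t. frechet_derivative ?F (at (z + t *\<^sub>R v)) v)"
    by (rule continuous_on_compose2) (use deriv(2) in \<open>auto intro!: continuous_intros\<close>)
  moreover have "vector_derivative (\<psi> \<circ> ?\<gamma>) (at t within {a..b}) = frechet_derivative ?F (at (z + t *\<^sub>R v)) v"
    if "t \<in> {a..b}" "?\<gamma> t \<in> U'" for t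
    by (rule vector_derivative_within_closed_interval
          [OF \<open>a < b\<close> that(1) has_vector_derivative_at_within[OF deriv(1)[OF that]]])
  ultimately show "continuous_on {t \<in> {a..b}. ?\<gamma> t \<in> U'}
      (\<lambda>t. vector_derivative (\<psi> \<circ> ?\<gamma>) (at t within {a..b}))"
    by (subst continuous_on_cong[OF refl]) auto
qed

text \<open>\<open>speed\<close> may pick a foreign chart; the transformation law of
  \<open>g\<close> leads back to \<open>\<phi>\<close>, where the velocity is
  \<open>v\<close>.\<close>

lemma segment_speed:
  fixes A :: "('a::topological_space, 'n::finite) chart set"
  assumes A: "smooth_atlas A" "riemannian_metric A g" "(U, \<phi>) \<in> A" and seg: "z + t *\<^sub>R v \<in> \<phi> ` U"
  shows "speed A g (\<lambda>t. inv_into U \<phi> (z + t *\<^sub>R v)) t = sqrt (g (U, \<phi>) (inv_into U \<phi> (z + t *\<^sub>R v)) v v)"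
proof -
  let ?\<gamma> = "\<lambda>t. inv_into U \<phi> (z + t *\<^sub>R v)"
  obtain U' \<psi> where U': "(U', \<psi>) \<in> A" "?\<gamma> t \<in> U'"
    and speed: "\<And>\<eta> s. \<eta> s = ?\<gamma> t \<Longrightarrow> speed A g \<eta> s =
      sqrt (g (U', \<psi>) (?\<gamma> t) (vector_derivative (\<psi> \<circ> \<eta>) (at s)) (vector_derivative (\<psi> \<circ> \<eta>) (at s)))"
    using speed_chart_ex[OF A(1), of "?\<gamma> t"] by metis
  let ?D = "frechet_derivative (\<psi> \<circ> inv_into U \<phi>) (at (z + t *\<^sub>R v))"
  have "vector_derivative (\<psi> \<circ> ?\<gamma>) (at t) = ?D v"
    by (rule vector_derivative_at[OF segment_has_vector_derivative(1)[OF A(1,3) U'(1) seg U'(2)]])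
  then have "speed A g ?\<gamma> t = sqrt (g (U', \<psi>) (?\<gamma> t) (?D v) (?D v))"
    using speed[of ?\<gamma> t] by simp
  moreover have "?\<gamma> t \<in> U \<inter> U'" "\<phi> (?\<gamma> t) = z + t *\<^sub>R v"
    using seg U'(2) by (auto intro: inv_into_into simp: f_inv_into_f)
  ultimately show ?thesis
    using riemannian_metric_transform[OF A(2,3) U'(1), of "?\<gamma> t" v v] by simp
qed

lemma riemannian_metric_locally_bounded:
  fixes A :: "('a::topological_space, 'n::finite) chart set"
  assumes "smooth_atlas A" "riemannian_metric A g" "(U, \<phi>) \<in> A" "p \<in> U"
  shows "\<exists>\<delta>>0. \<exists>C>0. ball (\<phi> p) \<delta> \<subseteq> \<phi> ` U \<and>
    (\<forall>y\<in>ball (\<phi> p) \<delta>. \<forall>v. g (U, \<phi>) (inv_into U \<phi> y) v v \<le> C * (norm v)\<^sup>2)"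
proof -
  note chart = smooth_atlas_chartD[OF assms(1,3)]
  let ?h = "\<lambda>y. g (U, \<phi>) (inv_into U \<phi> y)"
  \<comment> \<open>Since each component of \<open>v\<close> is at most \<open>norm v\<close> in
    absolute value, the sum of the absolute values of all coefficients bounds the quadratic
    form.\<close>
  let ?G = "\<lambda>y. \<Sum>i\<in>UNIV. \<Sum>j\<in>UNIV. \<bar>?h y (axis i 1) (axis j 1)\<bar>"
  \<comment> \<open>The added 1 makes \<open>C\<close> positive and puts \<open>\<phi> p\<close>
    strictly inside the open region where \<open>?G\<close> is below \<open>C\<close>.\<close>
  define C where "C = ?G (\<phi> p) + 1"
  have "0 \<le> ?G (\<phi> p)" by (intro sum_nonneg) auto
  then have "C > 0" unfolding C_def by linarith
  have "continuous_on (\<phi> ` U) ?G"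
    by (intro continuous_intros riemannian_metric_continuous[OF assms(2,3)])
  then have "open (\<phi> ` U \<inter> ?G -` {..<C})"
    using chart(2) by (rule continuous_open_preimage) auto
  moreover have "\<phi> p \<in> \<phi> ` U \<inter> ?G -` {..<C}"
    using assms(4) by (auto simp: C_def)
  ultimately obtain \<delta> where \<delta>: "\<delta> > 0" "ball (\<phi> p) \<delta> \<subseteq> \<phi> ` U \<inter> ?G -` {..<C}"
    unfolding open_contains_ball by blast
  have "?h y v v \<le> C * (norm v)\<^sup>2" if "y \<in> ball (\<phi> p) \<delta>" for y v
  proof -
    have y: "y \<in> \<phi> ` U" "?G y < C" using \<delta>(2) that by auto
    then have "bilinear (?h y)"
      using assms(2,3) inv_into_into[OF y(1)] unfolding riemannian_metric_def by fast
    then have "?h y v v = (\<Sum>i\<in>UNIV. \<Sum>j\<in>UNIV. v $ i * v $ j * ?h y (axis i 1) (axis j 1))"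
      by (rule bilinear_expansion_cart)
    also have "\<dots> \<le> (\<Sum>i\<in>UNIV. \<Sum>j\<in>UNIV. (norm v)\<^sup>2 * \<bar>?h y (axis i 1) (axis j 1)\<bar>)"
    proof (intro sum_mono)
      fix i j
      have "v $ i * v $ j * ?h y (axis i 1) (axis j 1) \<le> \<bar>v $ i\<bar> * \<bar>v $ j\<bar> * \<bar>?h y (axis i 1) (axis j 1)\<bar>"
        by (metis abs_ge_self abs_mult)
      also have "\<dots> \<le> norm v * norm v * \<bar>?h y (axis i 1) (axis j 1)\<bar>"
        by (intro mult_right_mono mult_mono component_le_norm_cart) auto
      finally show "v $ i * v $ j * ?h y (axis i 1) (axis j 1) \<le> (norm v)\<^sup>2 * \<bar>?h y (axis i 1) (axis j 1)\<bar>"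
        by (simp add: power2_eq_square)
    qed
    also have "\<dots> = ?G y * (norm v)\<^sup>2"
      by (simp add: sum_distrib_left mult.commute)
    also have "\<dots> \<le> C * (norm v)\<^sup>2"
      using y(2) by (intro mult_right_mono) auto
    finally show ?thesis .
  qed
  with \<delta> \<open>C > 0\<close> show ?thesis by blast
qed

text \<open>Over unit time the segment has constant coordinate velocity
  \<open>\<phi> y - \<phi> x\<close>; \<open>L\<close> bounds its speed and hence its
  length.\<close>

lemma riem_dist_segment_le:
  fixes A :: "('a::topological_space, 'n::finite) chart set"
  assumes A: "smooth_atlas A" "riemannian_metric A g" "(U, \<phi>) \<in> A" and x: "x \<in> U" and y: "y \<in> U"
    and sub: "\<And>t. t \<in> {0..1} \<Longrightarrow> \<phi> x + t *\<^sub>R (\<phi> y - \<phi> x) \<in> \<phi> ` U"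
    and bound: "\<And>t. t \<in> {0..1} \<Longrightarrow>
      g (U, \<phi>) (inv_into U \<phi> (\<phi> x + t *\<^sub>R (\<phi> y - \<phi> x))) (\<phi> y - \<phi> x) (\<phi> y - \<phi> x) \<le> L\<^sup>2"
    and "L \<ge> 0"
  shows "riem_dist A g x y \<le> ennreal L"
proof -
  note chart = smooth_atlas_chartD[OF A(1,3)]
  let ?\<gamma> = "\<lambda>t. inv_into U \<phi> (\<phi> x + t *\<^sub>R (\<phi> y - \<phi> x))"
  have "continuous_on {0..1} ?\<gamma>"
    by (rule continuous_on_compose2[OF chart(4)]) (use sub in \<open>auto intro!: continuous_intros\<close>)
  moreover have "C1_curve_on A ?\<gamma> s t" if "0 \<le> s" "s < t" "t \<le> 1" for s t
    using that by (intro segment_C1_curve_on[OF A(1,3)] sub) auto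
  ultimately have pw: "piecewise_C1_curve A ?\<gamma> 0 1"
    unfolding piecewise_C1_curve_def by blast
  have ends: "?\<gamma> 0 = x" "?\<gamma> 1 = y"
    using x y chart(5) by auto
  have "riem_dist A g x y \<le> curve_length A g ?\<gamma> 0 1"
    unfolding riem_dist_def
    by (intro Inf_lower CollectI exI[of _ ?\<gamma>] exI[of _ 0] exI[of _ 1] conjI refl pw ends) simp
  also have "\<dots> \<le> (\<integral>\<^sup>+t. ennreal L * indicator {0..1::real} t \<partial>lborel)"
    unfolding curve_length_def
  proof (rule nn_integral_mono)
    fix t :: real
    show "ennreal (speed A g ?\<gamma> t) * indicator {0..1} t \<le> ennreal L * indicator {0..1} t"
    proof (cases "t \<in> {0..1}")
      case True
      have "speed A g ?\<gamma> t \<le> sqrt (L\<^sup>2)"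
        unfolding segment_speed[OF A sub[OF True]] using bound[OF True] by (rule real_sqrt_le_mono)
      then show ?thesis using \<open>L \<ge> 0\<close> by (intro mult_right_mono ennreal_leI) auto
    qed simp
  qed
  also have "\<dots> = ennreal L"
    by (simp add: nn_integral_cmult_indicator)
  finally show ?thesis .
qed

lemma chart_ball_subset_riem_ball:
  fixes A :: "('a::topological_space, 'n::finite) chart set"
  assumes A: "smooth_atlas A" "riemannian_metric A g" "(U, \<phi>) \<in> A" and p: "p \<in> U" and "e > 0"
  obtains \<delta> where "\<delta> > 0" "ball (\<phi> p) \<delta> \<subseteq> \<phi> ` U" "U \<inter> \<phi> -` ball (\<phi> p) \<delta> \<subseteq> riem_ball A g p e"
proof -
  obtain d C where d: "d > 0" "C > 0" "ball (\<phi> p) d \<subseteq> \<phi> ` U"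
    "\<forall>y\<in>ball (\<phi> p) d. \<forall>v. g (U, \<phi>) (inv_into U \<phi> y) v v \<le> C * (norm v)\<^sup>2"
    using riemannian_metric_locally_bounded[OF A p] by blast
  \<comment> \<open>Below \<open>d\<close> the segment stays where the metric bound holds; below
    \<open>e / sqrt C\<close> its length, at most \<open>sqrt C\<close> times the Euclidean one, is
    less than \<open>e\<close>.\<close>
  define \<delta> where "\<delta> = min d (e / sqrt C)"
  have "\<delta> > 0" using d \<open>e > 0\<close> by (simp add: \<delta>_def)
  moreover have "ball (\<phi> p) \<delta> \<subseteq> \<phi> ` U" using d(3) by (auto simp: \<delta>_def)
  moreover have "riem_dist A g p y < ennreal e" if y: "y \<in> U" "\<phi> y \<in> ball (\<phi> p) \<delta>" for y
  proof -
    let ?v = "\<phi> y - \<phi> p"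
    have v: "norm ?v < d" "norm ?v < e / sqrt C"
      using y(2) by (auto simp: \<delta>_def dist_norm norm_minus_commute)
    have seg: "\<phi> p + t *\<^sub>R ?v \<in> ball (\<phi> p) d" if "t \<in> {0..1}" for t
    proof -
      have "norm (t *\<^sub>R ?v) \<le> 1 * norm ?v"
        using that unfolding norm_scaleR by (intro mult_right_mono) auto
      with v(1) show ?thesis by (simp add: dist_norm)
    qed
    have "riem_dist A g p y \<le> ennreal (sqrt C * norm ?v)"
    proof (rule riem_dist_segment_le[OF A p y(1)])
      fix t :: real assume t: "t \<in> {0..1}"
      show "\<phi> p + t *\<^sub>R ?v \<in> \<phi> ` U" using seg[OF t] d(3) by blast
      show "g (U, \<phi>) (inv_into U \<phi> (\<phi> p + t *\<^sub>R ?v)) ?v ?v \<le> (sqrt C * norm ?v)\<^sup>2"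
        using bspec[OF d(4) seg[OF t]] d(2) by (simp add: power_mult_distrib)
    qed (use d(2) in simp)
    also have "\<dots> < ennreal e"
      using v(2) d(2) \<open>e > 0\<close> by (intro ennreal_lessI) (simp_all add: field_simps)
    finally show ?thesis .
  qed
  ultimately show ?thesis by (intro that[of \<delta>]) (auto simp: riem_ball_def)
qed

section \<open>Transport cost from an empirical measure\<close>

lemma sets_empirical_measure [simp]: "sets (empirical_measure x N) = sets borel"
  unfolding empirical_measure_def
  by (metis sets.sigma_sets_eq sets_measure_of space_borel sets.space_closed)

lemma space_empirical_measure [simp]: "space (empirical_measure x N) = UNIV"
  unfolding empirical_measure_def by (metis space_borel space_measure_of sets.space_closed)

text \<open>\<open>measure_of\<close> returns the given set function only once it is known to be
  countably additive; here the series is exchanged with a finite sum.\<close>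

lemma emeasure_empirical_measure:
  assumes "B \<in> sets borel"
  shows "emeasure (empirical_measure x N) B =
    (1 / of_nat N) * (\<Sum>i=1..N. emeasure (return borel (x i)) B)"
proof (rule emeasure_measure_of[OF empirical_measure_def])
  show "countably_additive (sets (empirical_measure x N))
     (\<lambda>B. 1 / of_nat N * (\<Sum>i = 1..N. emeasure (return borel (x i)) B))"
  proof (rule countably_additiveI)
    fix F :: "nat \<Rightarrow> 'a set"
    assume F: "range F \<subseteq> sets (empirical_measure x N)" "disjoint_family F"
    then have "(\<Sum>n. emeasure (return borel (x i)) (F n)) = emeasure (return borel (x i)) (\<Union>(range F))" for i
      by (intro suminf_emeasure) auto
    then show "(\<Sum>n. 1 / of_nat N * (\<Sum>i = 1..N. emeasure (return borel (x i)) (F n))) =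
        1 / of_nat N * (\<Sum>i = 1..N. emeasure (return borel (x i)) (\<Union>(range F)))"
      by (simp add: suminf_sum)
  qed
qed (use assms in \<open>auto simp: positive_def\<close>)

lemma emeasure_coupling:
  assumes "\<pi> \<in> couplings \<mu> \<nu>"
  shows "S \<in> sets \<mu> \<Longrightarrow> emeasure \<pi> (S \<times> space \<nu>) = emeasure \<mu> S"
    and "T \<in> sets \<nu> \<Longrightarrow> emeasure \<pi> (space \<mu> \<times> T) = emeasure \<nu> T"
proof -
  from assms have sets: "sets \<pi> = sets (\<mu> \<Otimes>\<^sub>M \<nu>)"
    and d: "distr \<pi> \<mu> fst = \<mu>" "distr \<pi> \<nu> snd = \<nu>"
    by (auto simp: couplings_def)
  have m: "fst \<in> measurable \<pi> \<mu>" "snd \<in> measurable \<pi> \<nu>"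
    using measurable_cong_sets[OF sets refl] by auto
  have sp: "space \<pi> = space \<mu> \<times> space \<nu>"
    using sets_eq_imp_space_eq[OF sets] by (simp add: space_pair_measure)
  show "emeasure \<pi> (S \<times> space \<nu>) = emeasure \<mu> S" if S: "S \<in> sets \<mu>"
  proof -
    have "emeasure \<mu> S = emeasure (distr \<pi> \<mu> fst) S" by (simp add: d)
    also have "\<dots> = emeasure \<pi> (fst -` S \<inter> space \<pi>)" by (rule emeasure_distr[OF m(1) S])
    also have "fst -` S \<inter> space \<pi> = S \<times> space \<nu>"
      using sets.sets_into_space[OF S] by (auto simp: sp)
    finally show ?thesis ..
  qed
  show "emeasure \<pi> (space \<mu> \<times> T) = emeasure \<nu> T" if T: "T \<in> sets \<nu>"
  proof -
    have "emeasure \<nu> T = emeasure (distr \<pi> \<nu> snd) T" by (simp add: d)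
    also have "\<dots> = emeasure \<pi> (snd -` T \<inter> space \<pi>)" by (rule emeasure_distr[OF m(2) T])
    also have "snd -` T \<inter> space \<pi> = space \<mu> \<times> T"
      using sets.sets_into_space[OF T] by (auto simp: sp)
    finally show ?thesis ..
  qed
qed

text \<open>Used contrapositively: measures of different total mass have no coupling, so their
  \<open>W1\<close> is an infimum over the empty set.\<close>

lemma couplings_space_eq:
  assumes "\<pi> \<in> couplings \<mu> \<nu>"
  shows "emeasure \<mu> (space \<mu>) = emeasure \<nu> (space \<nu>)"
  using emeasure_coupling[OF assms] by (metis sets.top)

text \<open>A coupling has no mass over the complement of \<open>S\<close>, so all the mass that
  \<open>\<nu>\<close> gives to \<open>T\<close> sits on \<open>S \<times> T\<close>, where the cost
  is at least \<open>e\<close>.\<close>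

lemma W1_ge_separated:
  assumes S: "S \<in> sets \<mu>" "emeasure \<mu> (space \<mu> - S) = 0" and T: "T \<in> sets \<nu>"
    and d: "\<And>x y. x \<in> S \<Longrightarrow> y \<in> T \<Longrightarrow> e \<le> d x y"
  shows "e * emeasure \<nu> T \<le> W1 d \<mu> \<nu>"
  unfolding W1_def
proof (rule INF_greatest)
  fix \<pi> assume \<pi>: "\<pi> \<in> couplings \<mu> \<nu>"
  then have sets [measurable_cong]: "sets \<pi> = sets (\<mu> \<Otimes>\<^sub>M \<nu>)"
    by (simp add: couplings_def)
  note [measurable] = S(1) T
  have "emeasure \<nu> T = emeasure \<pi> (space \<mu> \<times> T)"
    using emeasure_coupling(2)[OF \<pi> T] ..
  also have "\<dots> \<le> emeasure \<pi> (S \<times> T \<union> (space \<mu> - S) \<times> space \<nu>)"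
    using sets.sets_into_space[OF T] by (intro emeasure_mono) (auto simp: sets)
  also have "\<dots> \<le> emeasure \<pi> (S \<times> T) + emeasure \<pi> ((space \<mu> - S) \<times> space \<nu>)"
    by (rule emeasure_subadditive) (auto simp: sets)
  also have "emeasure \<pi> ((space \<mu> - S) \<times> space \<nu>) = 0"
    using emeasure_coupling(1)[OF \<pi>, of "space \<mu> - S"] S by simp
  finally have "e * emeasure \<nu> T \<le> e * emeasure \<pi> (S \<times> T)"
    by (simp add: mult_left_mono)
  also have "\<dots> = (\<integral>\<^sup>+z. e * indicator (S \<times> T) z \<partial>\<pi>)"
    by (rule nn_integral_cmult_indicator[symmetric]) (simp add: sets)
  \<comment> \<open>Monotonicity of the lower integral holds for an arbitrary cost function
    \<open>d\<close>.\<close>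
  also have "\<dots> \<le> (\<integral>\<^sup>+(x, y). d x y \<partial>\<pi>)"
    using d by (intro nn_integral_mono) (auto split: split_indicator)
  finally show "e * emeasure \<nu> T \<le> (\<integral>\<^sup>+(x, y). d x y \<partial>\<pi>)" .
qed

lemma W1_empirical_measure_ge:
  fixes x :: "nat \<Rightarrow> 'a::t1_space"
  assumes "T \<in> sets \<nu>" and "\<And>i y. i \<ge> 1 \<Longrightarrow> y \<in> T \<Longrightarrow> e \<le> d (x i) y"
  shows "e * emeasure \<nu> T \<le> W1 d (empirical_measure x N) \<nu>"
proof (rule W1_ge_separated)
  let ?S = "x ` {1..N}"
  \<comment> \<open>The measure is carried by a finite set, which is closed in a T1 space.\<close>
  have S: "?S \<in> sets borel"
    by (intro borel_closed finite_imp_closed) simp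
  then show "?S \<in> sets (empirical_measure x N)" by simp
  have "- ?S \<in> sets borel" using S by auto
  then show "emeasure (empirical_measure x N) (space (empirical_measure x N) - ?S) = 0"
    using S by (auto simp: emeasure_empirical_measure Compl_eq_Diff_UNIV indicator_def)
qed (use assms in auto)

lemma emeasure_empirical_measure_UNIV:
  assumes "N \<ge> 1"
  shows "emeasure (empirical_measure x N) UNIV = 1"
proof -
  have "emeasure (empirical_measure x N) UNIV = 1 / of_nat N * of_nat N"
    by (simp add: emeasure_empirical_measure)
  also have "\<dots> = of_nat N / of_nat N"
    by (simp add: ennreal_times_divide mult.commute)
  also have "\<dots> = 1"
    using assms by (intro ennreal_divide_self) (auto simp: of_nat_less_top)
  finally show ?thesis .
qed

lemma sets_normalized [simp]: "sets (normalized V) = sets V"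
  by (simp add: normalized_def)

theorem proposition4p1:
  fixes A :: "('a::{t2_space, second_countable_topology}, 'n::finite) chart set"
    and g :: "('a, 'n) bilinear_field"
    and V dx :: "'a measure"
    and p :: 'a and r :: real and x :: "nat \<Rightarrow> 'a"
  assumes "compact_riemannian_manifold A g"
    and "is_riemannian_volume A g V"
    and "dx = normalized V"
    and "r > 0"
    and "\<And>i. i \<ge> 1 \<Longrightarrow> x i \<in> UNIV - riem_ball A g p r"
  shows "(\<forall>N\<ge>1. W1 (riem_dist A g) (empirical_measure x N) dx
             \<ge> ennreal (r / 2) * emeasure dx (riem_ball A g p (r / 2)))
       \<and> \<not> W1_converges (riem_dist A g) (empirical_measure x) dx"
proof -
  have A: "smooth_atlas A" "riemannian_metric A g"
    using assms(1) by (auto simp: compact_riemannian_manifold_def)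
  have sets: "sets dx = sets borel"
    using assms(2,3) by (simp add: is_riemannian_volume_def)
  \<comment> \<open>Otherwise \<open>p\<close> and \<open>x i\<close> would both be nearer than
    \<open>r / 2\<close> to \<open>y\<close>, which would put \<open>x i\<close> into the excluded
    ball.\<close>
  have sep: "ennreal (r / 2) \<le> riem_dist A g (x i) y"
    if "i \<ge> 1" "y \<in> riem_ball A g p (r / 2)" for i y
  proof (rule ccontr)
    assume "\<not> ennreal (r / 2) \<le> riem_dist A g (x i) y"
    then have "riem_dist A g p (x i) < ennreal (r / 2) + ennreal (r / 2)"
      using that(2) by (intro riem_dist_less_add[OF A]) (auto simp: riem_ball_def)
    also have "\<dots> = ennreal r"
      using assms(4) by (simp flip: ennreal_plus)
    finally show False
      using assms(5)[OF that(1)] by (simp add: riem_ball_def)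
  qed
  \<comment> \<open>Stated for every measurable part of the ball, so that it also applies to a
    coordinate ball.\<close>
  have bound: "ennreal (r / 2) * emeasure dx T \<le> W1 (riem_dist A g) (empirical_measure x N) dx"
    if "T \<in> sets dx" "T \<subseteq> riem_ball A g p (r / 2)" for T N
    using that sep by (intro W1_empirical_measure_ge) auto
  \<comment> \<open>Off the sigma-algebra \<open>emeasure\<close> is 0 and the inequality is
    trivial.\<close>
  have "ennreal (r / 2) * emeasure dx (riem_ball A g p (r / 2)) \<le> W1 (riem_dist A g) (empirical_measure x N) dx"
    for N
    using bound by (cases "riem_ball A g p (r / 2) \<in> sets dx") (auto simp: emeasure_notin_sets)
  moreover have "\<exists>k>0. \<forall>N\<ge>1. k \<le> W1 (riem_dist A g) (empirical_measure x N) dx"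
  proof -
    obtain U \<phi> where U: "(U, \<phi>) \<in> A" "p \<in> U"
      using smooth_atlas_chart_ex[OF A(1)] .
    obtain \<delta> where \<delta>: "\<delta> > 0" "ball (\<phi> p) \<delta> \<subseteq> \<phi> ` U"
      "U \<inter> \<phi> -` ball (\<phi> p) \<delta> \<subseteq> riem_ball A g p (r / 2)"
      using chart_ball_subset_riem_ball[OF A U, of "r / 2"] assms(4) by auto
    let ?O = "U \<inter> \<phi> -` ball (\<phi> p) \<delta>"
    have O: "?O \<in> sets dx" "emeasure V ?O > 0"
      using chart_ball_open[OF A(1) U(1)] emeasure_volume_chart_ball_pos[OF A assms(2) U \<delta>(1,2)]
      by (auto simp: sets)
    show ?thesis
    proof (cases "emeasure V (space V) = \<infinity>")
      case True
      \<comment> \<open>Then \<open>dx = 0\<close> and there are no couplings, so the infimum is \<open>\<infinity>\<close>.\<close>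
      then have "emeasure dx (space dx) = 0"
        by (simp add: assms(3) normalized_def)
      then have "couplings (empirical_measure x N) dx = {}" if "N \<ge> 1" for N
        using couplings_space_eq[of _ "empirical_measure x N" dx] emeasure_empirical_measure_UNIV[OF that, of x]
        by fastforce
      then have "W1 (riem_dist A g) (empirical_measure x N) dx = \<infinity>" if "N \<ge> 1" for N
        using that by (simp add: W1_def)
      then show ?thesis by (intro exI[of _ 1]) simp
    next
      case False
      \<comment> \<open>The normalizing factor is the inverse of a finite mass, hence
        positive.\<close>
      then have "emeasure dx ?O > 0"
        using O(2) by (simp add: assms(3) normalized_def ennreal_zero_less_mult_iff ennreal_inverse_positive)
      then have "ennreal (r / 2) * emeasure dx ?O > 0"
        using assms(4) by (simp add: ennreal_zero_less_mult_iff)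
      with bound[OF O(1) \<delta>(3)] show ?thesis by blast
    qed
  qed
  then obtain k where k: "k > 0" "\<And>N. N \<ge> 1 \<Longrightarrow> k \<le> W1 (riem_dist A g) (empirical_measure x N) dx"
    by blast
  have "\<not> W1_converges (riem_dist A g) (empirical_measure x) dx"
  proof
    assume "W1_converges (riem_dist A g) (empirical_measure x) dx"
    then have "\<forall>\<^sub>F N in sequentially. W1 (riem_dist A g) (empirical_measure x N) dx < k"
      unfolding W1_converges_def using k(1) by (rule order_tendstoD(2))
    then obtain M where "\<And>N. N \<ge> M \<Longrightarrow> W1 (riem_dist A g) (empirical_measure x N) dx < k"
      unfolding eventually_sequentially by blast
    \<comment> \<open>The lower bound \<open>k\<close> is available from index 1 on, while
      \<open>M\<close> may be 0.\<close>
    from this[of "max M 1"] k(2)[of "max M 1"] show False by simp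
  qed
  ultimately show ?thesis by blast
qed

end
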